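(* Let $A\in\mathbb{R}^{n\times n}$ have rank one. Then $A$ is a Karamardian matrix if and only if $(A^{\dagger})^T$ is a Karamardian matrix. Moreover, if $A$ is Karamardian then both $A^T$ and $A^{\dagger}$ are row monotone.
   Context: $A^{\dagger}$ denotes the Moore–Penrose inverse of $A$. A square matrix $M$ is row monotone if $Mx\ge 0$ and $x\in R(M^T)$ imply $x\ge 0$. For $A\in\mathbb{R}^{n\times n}$ let $K_A=\mathbb{R}^n_+\cap R(A)$ and $K_A^*=\{y\in\mathbb{R}^n: x^Ty\ge 0 \text{ for all } x\in K_A\}$ (one has $K_A^*=\mathbb{R}^n_++N(A^T)$, and its interior is $\{a+b: a>0,\ b\in N(A^T)\}$). For $q\in\mathbb{R}^n$, LCP$(A,K_A,q)$ is to find $x$ with $x\in K_A$, $Ax+q\in K_A^*$, $x^T(Ax+q)=0$. $A$ is a Karamardian matrix if $K_A\ne\{0\}$ and there exists $d$ in the interior of $K_A^*$ such that both LCP$(A,K_A,0)$ and LCP$(A,K_A,d)$ have $x=0$ as their only solution. *)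

theory Defs
  imports "HOL-Analysis.Analysis"
begin

text \<open>Componentwise nonnegativity of a vector (x \<ge> 0).\<close>
definition nonneg_vec :: "real^'n \<Rightarrow> bool" where
  "nonneg_vec x \<longleftrightarrow> (\<forall>i. 0 \<le> x $ i)"

text \<open>Moore--Penrose inverse: the unique X satisfying the four Penrose equations.\<close>
definition is_moore_penrose :: "real^'n^'m \<Rightarrow> real^'m^'n \<Rightarrow> bool" where
  "is_moore_penrose A X \<longleftrightarrow>
     A ** X ** A = A \<and> X ** A ** X = X \<and>
     transpose (A ** X) = A ** X \<and> transpose (X ** A) = X ** A"

definition mp_inverse :: "real^'n^'m \<Rightarrow> real^'m^'n" where
  "mp_inverse A = (THE X. is_moore_penrose A X)"

text \<open>Row monotone: M x \<ge> 0 and x \<in> R(M^T) imply x \<ge> 0.\<close>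
definition row_monotone :: "real^'n^'n \<Rightarrow> bool" where
  "row_monotone M \<longleftrightarrow>
     (\<forall>x. nonneg_vec (M *v x) \<and> x \<in> range ((*v) (transpose M)) \<longrightarrow> nonneg_vec x)"

text \<open>K_A = R^n_+ \<inter> R(A).\<close>
definition K_cone :: "real^'n^'n \<Rightarrow> (real^'n) set" where
  "K_cone A = {x. nonneg_vec x} \<inter> range ((*v) A)"

text \<open>Dual cone K_A^*.\<close>
definition K_dual :: "real^'n^'n \<Rightarrow> (real^'n) set" where
  "K_dual A = {y. \<forall>x\<in>K_cone A. 0 \<le> x \<bullet> y}"

text \<open>x solves LCP(A, K_A, q).\<close>
definition LCP_sol :: "real^'n^'n \<Rightarrow> real^'n \<Rightarrow> real^'n \<Rightarrow> bool" where
  "LCP_sol A q x \<longleftrightarrow>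
     x \<in> K_cone A \<and> A *v x + q \<in> K_dual A \<and> x \<bullet> (A *v x + q) = 0"

definition karamardian :: "real^'n^'n \<Rightarrow> bool" where
  "karamardian A \<longleftrightarrow> K_cone A \<noteq> {0} \<and>
     (\<exists>d\<in>interior (K_dual A).
        (\<forall>x. LCP_sol A 0 x \<longrightarrow> x = 0) \<and> (\<forall>x. LCP_sol A d x \<longrightarrow> x = 0))"

end

theory Submission
  imports Defs
begin

text \<open>
  A rank-one matrix is an outer product \<open>A = u v\<^sup>T\<close>, and its Moore--Penrose inverse is the
  positive multiple \<open>v u\<^sup>T / (\<parallel>u\<parallel>\<^sup>2 \<parallel>v\<parallel>\<^sup>2)\<close> of \<open>A\<^sup>T\<close>.
  For an outer product \<open>w v\<^sup>T\<close> with \<open>v \<noteq> 0\<close> the cone \<open>K_A\<close> is the ray through \<open>w\<close>, so the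
  LCPs reduce to scalar problems along that ray.  Solving them shows that \<open>A\<close> is Karamardian
  exactly when it can be written as \<open>w v\<^sup>T\<close> with \<open>w \<ge> 0\<close> and \<open>v \<bullet> w > 0\<close>.  This condition is
  invariant under \<open>A \<mapsto> (A\<^sup>\<dagger>)\<^sup>T\<close>, and it makes \<open>v w\<^sup>T\<close> row monotone: \<open>R(w v\<^sup>T)\<close> is the line
  through \<open>w\<close>, and \<open>v w\<^sup>T (t w) = t \<parallel>w\<parallel>\<^sup>2 v \<ge> 0\<close> with \<open>t < 0\<close> would force \<open>v \<le> 0\<close>, hence \<open>v \<bullet> w \<le> 0\<close>.
\<close>

definition outer :: "real^'n \<Rightarrow> real^'m \<Rightarrow> real^'m^'n" where
  "outer u v = (\<chi> i j. u$i * v$j)"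

lemma outer_mult_vec: "outer u v *v x = (v \<bullet> x) *\<^sub>R u"
  by (simp add: vec_eq_iff outer_def matrix_vector_mult_def inner_vec_def sum_distrib_left algebra_simps)

lemma transpose_outer: "transpose (outer u v) = outer v u"
  by (simp add: vec_eq_iff outer_def transpose_def)

lemma outer_mult_outer: "outer a b ** outer c d = outer ((b \<bullet> c) *\<^sub>R a) d"
  by (simp add: vec_eq_iff outer_def matrix_matrix_mult_def inner_vec_def sum_distrib_left
      sum_distrib_right algebra_simps)

lemma scaleR_outer_left: "outer (k *\<^sub>R a) b = k *\<^sub>R outer a b"
  by (simp add: vec_eq_iff outer_def)

lemma scaleR_outer_right: "outer a (k *\<^sub>R b) = k *\<^sub>R outer a b"
  by (simp add: vec_eq_iff outer_def)

lemma outer_zero_right [simp]: "outer u 0 = 0"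
  by (simp add: vec_eq_iff outer_def)

lemma range_outer:
  assumes "v \<noteq> 0"
  shows "range ((*v) (outer w v)) = range (\<lambda>t. t *\<^sub>R w)"
proof (intro set_eqI iffI)
  fix y assume "y \<in> range (\<lambda>t. t *\<^sub>R w)"
  then obtain t where "y = t *\<^sub>R w" by auto
  then have "y = outer w v *v ((t / (v \<bullet> v)) *\<^sub>R v)"
    using assms by (simp add: outer_mult_vec)
  then show "y \<in> range ((*v) (outer w v))" by auto
qed (auto simp: outer_mult_vec)

lemma rank_one_obtains_outer:
  fixes A :: "real^'n^'m"
  assumes "rank A = 1"
  obtains u v where "u \<noteq> 0" "v \<noteq> 0" "A = outer u v"
proof -
  obtain B where B: "independent B" "range ((*v) A) \<subseteq> span B" "card B = dim (range ((*v) A))"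
    using basis_exists by blast
  then obtain u where Bu: "B = {u}"
    using assms rank_dim_range[of A] card_1_singletonE by auto
  have "\<forall>j. \<exists>c. A *v axis j 1 = c *\<^sub>R u"
    using B(2) Bu by (auto simp: span_singleton)
  then obtain c where c: "\<And>j. A *v axis j 1 = c j *\<^sub>R u" by metis
  have A: "A = outer u (\<chi> j. c j)"
  proof -
    have "A $ i $ j = (A *v axis j 1) $ i" for i j
      by (simp add: matrix_vector_mult_basis column_def)
    then show ?thesis by (simp add: vec_eq_iff outer_def c)
  qed
  moreover have "(\<chi> j. c j) \<noteq> 0"
    using assms A by auto
  moreover have "u \<noteq> 0"
    using B(1) Bu by auto
  ultimately show ?thesis using that by blast
qed

lemma moore_penrose_unique:
  fixes A :: "real^'n^'m"
  assumes X: "is_moore_penrose A X" and Y: "is_moore_penrose A Y"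
  shows "X = Y"
proof -
  have x: "A ** X ** A = A" "X ** A ** X = X" "transpose (A ** X) = A ** X" "transpose (X ** A) = X ** A"
    using X by (auto simp: is_moore_penrose_def)
  have y: "A ** Y ** A = A" "Y ** A ** Y = Y" "transpose (A ** Y) = A ** Y" "transpose (Y ** A) = Y ** A"
    using Y by (auto simp: is_moore_penrose_def)
  have "X = X ** transpose (A ** X)"
    using x by (simp add: matrix_mul_assoc)
  also have "\<dots> = X ** (transpose X ** transpose (A ** Y ** A))"
    using y by (simp add: matrix_transpose_mul)
  also have "\<dots> = X ** (transpose (A ** X) ** transpose (A ** Y))"
    by (simp add: matrix_transpose_mul matrix_mul_assoc)
  also have "\<dots> = X ** A ** Y"
    using x y by (metis matrix_mul_assoc)
  finally have XY: "X = X ** A ** Y" .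
  have "Y = transpose (Y ** A) ** Y"
    using y by simp
  also have "\<dots> = (transpose (A ** X ** A) ** transpose Y) ** Y"
    using x by (simp add: matrix_transpose_mul)
  also have "\<dots> = (transpose (X ** A) ** transpose (Y ** A)) ** Y"
    by (simp add: matrix_transpose_mul matrix_mul_assoc)
  also have "\<dots> = X ** A ** Y"
    using x y by (metis matrix_mul_assoc)
  finally show ?thesis
    using XY by simp
qed

lemma mp_inverse_outer:
  fixes u v :: "real^'n"
  assumes "u \<noteq> 0" "v \<noteq> 0"
  shows "mp_inverse (outer u v) = outer ((1 / ((u \<bullet> u) * (v \<bullet> v))) *\<^sub>R v) u"
proof -
  have "u \<bullet> u > 0" "v \<bullet> v > 0"
    using assms by auto
  then have "is_moore_penrose (outer u v) (outer ((1 / ((u \<bullet> u) * (v \<bullet> v))) *\<^sub>R v) u)"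
    unfolding is_moore_penrose_def outer_mult_outer transpose_outer
    by (simp add: scaleR_outer_left scaleR_outer_right inner_commute)
  then show ?thesis
    unfolding mp_inverse_def using moore_penrose_unique by blast
qed

lemma K_cone_outer:
  assumes w: "nonneg_vec w" "w \<noteq> 0" and v: "v \<noteq> 0"
  shows "K_cone (outer w v) = {t *\<^sub>R w | t. 0 \<le> t}"
proof -
  obtain i where "w $ i \<noteq> 0"
    using w(2) by (auto simp: vec_eq_iff)
  then have wi: "0 < w $ i"
    using w(1) by (simp add: nonneg_vec_def order_less_le)
  have "0 \<le> t" if "nonneg_vec (t *\<^sub>R w)" for t
  proof -
    have "0 \<le> t * w $ i"
      using that by (simp add: nonneg_vec_def)
    then show ?thesis
      using wi by (simp add: zero_le_mult_iff)
  qed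
  moreover have "nonneg_vec (t *\<^sub>R w)" if "0 \<le> t" for t
    using that w(1) by (simp add: nonneg_vec_def)
  ultimately show ?thesis
    unfolding K_cone_def range_outer[OF v] by blast
qed

lemma generator_in_K_cone_outer:
  assumes "nonneg_vec w" "w \<noteq> 0" "v \<noteq> 0"
  shows "w \<in> K_cone (outer w v)"
  unfolding K_cone_outer[OF assms] by (metis (mono_tags) mem_Collect_eq scale_one zero_le_one)

lemma K_dual_outer:
  assumes "nonneg_vec w" "w \<noteq> 0" "v \<noteq> 0"
  shows "K_dual (outer w v) = {y. 0 \<le> w \<bullet> y}"
  using generator_in_K_cone_outer[OF assms] by (auto simp: K_dual_def K_cone_outer[OF assms])

lemma LCP_sol_outer:
  assumes "nonneg_vec w" "w \<noteq> 0" "v \<noteq> 0"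
  shows "LCP_sol (outer w v) q x \<longleftrightarrow>
    (\<exists>t\<ge>0. x = t *\<^sub>R w \<and> 0 \<le> t * (v \<bullet> w) * (w \<bullet> w) + w \<bullet> q \<and>
            t * (t * (v \<bullet> w) * (w \<bullet> w) + w \<bullet> q) = 0)"
proof -
  have "w \<bullet> (outer w v *v (t *\<^sub>R w) + q) = t * (v \<bullet> w) * (w \<bullet> w) + w \<bullet> q" for t
    by (simp add: outer_mult_vec inner_add_right)
  then show ?thesis
    unfolding LCP_sol_def K_cone_outer[OF assms] K_dual_outer[OF assms] by auto
qed

text \<open>\<open>d - t x\<close> stays in \<open>K_A\<^sup>*\<close> for small \<open>t > 0\<close>, so \<open>x \<bullet> d \<ge> t \<parallel>x\<parallel>\<^sup>2 > 0\<close>.\<close>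

lemma inner_pos_interior_K_dual:
  assumes d: "d \<in> interior (K_dual A)" and x: "x \<in> K_cone A" "x \<noteq> 0"
  shows "0 < x \<bullet> d"
proof -
  obtain e where e: "e > 0" "ball d e \<subseteq> K_dual A"
    using d mem_interior by blast
  define t where "t = e / (2 * norm x)"
  have t: "t > 0"
    using e x(2) by (simp add: t_def)
  have "d - t *\<^sub>R x \<in> ball d e"
    using e x(2) by (simp add: dist_norm t_def)
  then have "d - t *\<^sub>R x \<in> K_dual A"
    using e by blast
  then have "0 \<le> x \<bullet> (d - t *\<^sub>R x)"
    using x(1) by (simp add: K_dual_def)
  moreover have "0 < t * (x \<bullet> x)"
    using t x(2) by simp
  ultimately show ?thesis
    by (simp add: inner_diff_right)
qed

lemma karamardian_outer:
  assumes w: "nonneg_vec w" and vw: "0 < v \<bullet> w"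
  shows "karamardian (outer w v)"
proof -
  have nz: "w \<noteq> 0" "v \<noteq> 0" "0 < w \<bullet> w"
    using vw by auto
  have "K_cone (outer w v) \<noteq> {0}"
    using generator_in_K_cone_outer[OF w nz(1,2)] nz by auto
  moreover have "w \<in> interior (K_dual (outer w v))"
    unfolding K_dual_outer[OF w nz(1,2)]
    using nz(3) open_halfspace_gt[of 0 w] interior_maximal[of "{y. 0 < w \<bullet> y}"] by force
  moreover have "x = 0" if "LCP_sol (outer w v) 0 x" for x
    using that vw nz(3) by (auto simp: LCP_sol_outer[OF w nz(1,2)])
  moreover have "x = 0" if sol: "LCP_sol (outer w v) w x" for x
  proof -
    obtain t where t: "0 \<le> t" "x = t *\<^sub>R w" "t * (t * (v \<bullet> w) * (w \<bullet> w) + w \<bullet> w) = 0"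
      using sol unfolding LCP_sol_outer[OF w nz(1,2)] by (elim exE conjE) simp
    have "0 < t * (v \<bullet> w) * (w \<bullet> w) + w \<bullet> w"
      using t(1) vw nz(3) by (simp add: add_nonneg_pos)
    then show ?thesis
      using t by simp
  qed
  ultimately show ?thesis
    unfolding karamardian_def by blast
qed

lemma karamardian_outer_inner_pos:
  assumes K: "karamardian (outer w v)" and w: "nonneg_vec w" "w \<noteq> 0" and v: "v \<noteq> 0"
  shows "0 < v \<bullet> w"
proof (rule ccontr)
  assume "\<not> 0 < v \<bullet> w"
  then consider "v \<bullet> w = 0" | "v \<bullet> w < 0" by linarith
  then show False
  proof cases
    case 1
    then have "LCP_sol (outer w v) 0 w"
      unfolding LCP_sol_outer[OF w v] by (intro exI[of _ 1]) simp
    then show False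
      using K w(2) by (auto simp: karamardian_def)
  next
    case 2
    obtain d where d: "d \<in> interior (K_dual (outer w v))"
      and uniq: "\<And>x. LCP_sol (outer w v) d x \<Longrightarrow> x = 0"
      using K by (auto simp: karamardian_def)
    have wd: "0 < w \<bullet> d"
      using inner_pos_interior_K_dual[OF d generator_in_K_cone_outer[OF w v] w(2)] .
    define c where "c = - (v \<bullet> w) * (w \<bullet> w)"
    define t where "t = (w \<bullet> d) / c"
    have c: "0 < c"
      unfolding c_def using 2 w(2) by (simp add: mult_neg_pos)
    have t: "0 < t" "t * c = w \<bullet> d"
      unfolding t_def using wd c by (simp_all add: divide_pos_pos)
    have "t * (v \<bullet> w) * (w \<bullet> w) + w \<bullet> d = 0"
      using t(2) by (simp add: c_def algebra_simps)
    then have "LCP_sol (outer w v) d (t *\<^sub>R w)"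
      unfolding LCP_sol_outer[OF w v] using t(1) by (intro exI[of _ t]) simp
    then show False
      using uniq t w(2) by fastforce
  qed
qed

lemma karamardian_outer_obtains:
  assumes K: "karamardian (outer u v)"
  obtains w v' where "outer u v = outer w v'" "nonneg_vec w" "0 < v' \<bullet> w"
proof -
  have "0 \<in> K_cone (outer u v)"
    by (auto simp: K_cone_def nonneg_vec_def intro: range_eqI[of _ _ 0])
  then obtain z where z: "z \<in> K_cone (outer u v)" "z \<noteq> 0"
    using K unfolding karamardian_def by blast
  then obtain y where zy: "z = (v \<bullet> y) *\<^sub>R u" and zn: "nonneg_vec z"
    by (auto simp: K_cone_def outer_mult_vec)
  have a: "v \<bullet> y \<noteq> 0"
    using z(2) zy by auto
  define v' where "v' = (1 / (v \<bullet> y)) *\<^sub>R v"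
  have uv: "outer u v = outer z v'"
    using a by (simp add: zy v'_def scaleR_outer_left scaleR_outer_right)
  have "v' \<noteq> 0"
    using K uv z by (auto simp: karamardian_def K_cone_def)
  then have "0 < v' \<bullet> z"
    using karamardian_outer_inner_pos[OF _ zn z(2)] K uv by simp
  then show ?thesis
    using that uv zn by blast
qed

lemma karamardian_outer_scaleR_right:
  assumes c: "0 < c"
  shows "karamardian (outer u (c *\<^sub>R v)) \<longleftrightarrow> karamardian (outer u v)"
proof -
  have *: "karamardian (outer u (c *\<^sub>R v))" if K: "karamardian (outer u v)" and c: "0 < c" for c v
  proof -
    obtain w v' where "outer u v = outer w v'" "nonneg_vec w" "0 < v' \<bullet> w"
      using karamardian_outer_obtains[OF K] .
    moreover have "outer u (c *\<^sub>R v) = outer w (c *\<^sub>R v')"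
      using calculation(1) by (simp add: scaleR_outer_right)
    ultimately show ?thesis
      using c karamardian_outer[of w "c *\<^sub>R v'"] by simp
  qed
  show ?thesis
    using *[of v c] *[of "c *\<^sub>R v" "1 / c"] c by auto
qed

lemma row_monotone_outer:
  assumes w: "nonneg_vec w" and vw: "0 < v \<bullet> w"
  shows "row_monotone (outer v w)"
  unfolding row_monotone_def
proof (intro allI impI)
  fix x assume x: "nonneg_vec (outer v w *v x) \<and> x \<in> range ((*v) (transpose (outer v w)))"
  have "v \<noteq> 0" "0 < w \<bullet> w"
    using vw by auto
  then obtain t where xt: "x = t *\<^sub>R w"
    using x by (auto simp: transpose_outer range_outer)
  have "0 \<le> t"
  proof (rule ccontr)
    assume "\<not> 0 \<le> t"
    then have "t * (w \<bullet> w) < 0"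
      using \<open>0 < w \<bullet> w\<close> by (simp add: mult_neg_pos)
    moreover have "0 \<le> t * (w \<bullet> w) * v $ i" for i
      using x by (simp add: xt outer_mult_vec nonneg_vec_def)
    ultimately have "v $ i \<le> 0" for i
      by (meson mult_neg_pos not_le)
    then have "v \<bullet> w \<le> 0"
      using w unfolding inner_vec_def nonneg_vec_def by (simp add: sum_nonpos mult_nonpos_nonneg)
    then show False
      using vw by simp
  qed
  then show "nonneg_vec x"
    using w xt by (simp add: nonneg_vec_def)
qed

theorem mainTheorem8:
  fixes A :: "real^'n^'n"
  assumes "rank A = 1"
  shows "(karamardian A \<longleftrightarrow> karamardian (transpose (mp_inverse A))) \<and>
         (karamardian A \<longrightarrow> row_monotone (transpose A) \<and> row_monotone (mp_inverse A))"
proof -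
  obtain u v where uv: "u \<noteq> 0" "v \<noteq> 0" "A = outer u v"
    using rank_one_obtains_outer[OF assms] .
  have "0 < 1 / ((u \<bullet> u) * (v \<bullet> v))"
    using uv by simp
  then have "karamardian A \<longleftrightarrow> karamardian (transpose (mp_inverse A))"
    using uv by (simp add: mp_inverse_outer transpose_outer karamardian_outer_scaleR_right)
  moreover have "row_monotone (transpose A) \<and> row_monotone (mp_inverse A)" if "karamardian A"
  proof -
    obtain w v where A: "A = outer w v" and w: "nonneg_vec w" and vw: "0 < v \<bullet> w"
      using karamardian_outer_obtains \<open>karamardian A\<close> uv(3) by metis
    have nz: "w \<noteq> 0" "v \<noteq> 0"
      using vw by auto
    then have "0 < ((1 / ((w \<bullet> w) * (v \<bullet> v))) *\<^sub>R v) \<bullet> w"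
      using vw by (simp add: divide_pos_pos)
    then show ?thesis
      using row_monotone_outer[OF w] vw by (simp add: A transpose_outer mp_inverse_outer[OF nz])
  qed
  ultimately show ?thesis
    by blast
qed

end
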